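(* Let $F$ be a field of characteristic zero and $n\ge 4$ an integer. If $g:N_n(F)\rightarrow N_n(F)$ is an $F$-linear map such that $[g(X),X]\in Z(N_n(F))$ for all $X\in N_n(F)$, then there exist $\lambda\in F$ and an additive map $\mu:N_n(F)\rightarrow\Omega$ such that $g(X)=\lambda X+\mu(X)$ for all $X\in N_n(F)$, where $\Omega=\{ae_{1,n-1}+be_{1,n}+ce_{2,n}:a,b,c\in F\}$.
   Context: $N_n(F)$ denotes the (non-unital) ring of $n\times n$ strictly upper triangular matrices with entries in $F$, and $Z(N_n(F))$ denotes its center, which is known to equal $\{ae_{1,n}:a\in F\}$. $[A,B]=AB-BA$ is the ring commutator. $e_{i,j}$ denotes the standard matrix unit with a $1$ in position $(i,j)$ and all other entries $0$. *)

theory Defs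
  imports "Jordan_Normal_Form.Matrix"
begin

definition strict_upper_mats :: "nat \<Rightarrow> 'a :: zero mat set" where
  "strict_upper_mats n = {A \<in> carrier_mat n n. \<forall>i < n. \<forall>j \<le> i. A $$ (i, j) = 0}"

definition center :: "'a :: semiring_0 mat set \<Rightarrow> 'a mat set" where
  "center R = {A \<in> R. \<forall>B \<in> R. A * B = B * A}"

definition commutator :: "'a :: ring mat \<Rightarrow> 'a mat \<Rightarrow> 'a mat" where
  "commutator A B = A * B - B * A"

text \<open>Indices start at 0 (as for \<open>mat\<close>), so the matrix written $e_{i,j}$ with indices
  starting at 1 is \<open>mat_unit n (i - 1) (j - 1)\<close>.\<close>

definition mat_unit :: "nat \<Rightarrow> nat \<Rightarrow> nat \<Rightarrow> 'a :: zero_neq_one mat" where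
  "mat_unit n i j = mat n n (\<lambda>(k, l). if k = i \<and> l = j then 1 else 0)"

text \<open>The span of $e_{1,n-1}$, $e_{1,n}$, $e_{2,n}$ in 1-based notation.\<close>

definition Omega :: "nat \<Rightarrow> 'a :: field mat set" where
  "Omega n = {a \<cdot>\<^sub>m mat_unit n 0 (n - 2) + b \<cdot>\<^sub>m mat_unit n 0 (n - 1)
              + c \<cdot>\<^sub>m mat_unit n 1 (n - 1) | a b c. True}"

definition additive_on :: "'a :: plus mat set \<Rightarrow> ('a mat \<Rightarrow> 'a mat) \<Rightarrow> bool" where
  "additive_on V f \<longleftrightarrow> (\<forall>X \<in> V. \<forall>Y \<in> V. f (X + Y) = f X + f Y)"

definition linear_map_on :: "'a :: semiring_0 mat set \<Rightarrow> ('a mat \<Rightarrow> 'a mat) \<Rightarrow> bool" where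
  "linear_map_on V f \<longleftrightarrow> additive_on V f \<and> (\<forall>c. \<forall>X \<in> V. f (c \<cdot>\<^sub>m X) = c \<cdot>\<^sub>m f X)"

end

theory Submission
  imports Defs
begin

text \<open>
  An equation \<open>f X * X\<^sub>r\<^sub>s = X\<^sub>p\<^sub>q * h X\<close> between linear functionals \<open>f\<close>, \<open>h\<close> and two different coordinates
  forces \<open>f X = c * X\<^sub>p\<^sub>q\<close> and \<open>h X = c * X\<^sub>r\<^sub>s\<close> with a common scalar \<open>c\<close>. If the superdiagonals below
  the \<open>d\<close>-th of \<open>g X\<close> vanish, every entry of \<open>[g X, X]\<close> on superdiagonal \<open>d + 1\<close> other than the
  corner gives such an equation. For \<open>d = 1\<close> this shows that \<open>g\<close> is a scalar \<open>\<lambda>\<close> on the first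
  superdiagonal; after replacing \<open>g\<close> by \<open>g - \<lambda>\<close>, for \<open>2 \<le> d \<le> n - 3\<close> two neighbouring equations
  are compatible only when the whole superdiagonal \<open>d\<close> is zero. What remains are the last two
  superdiagonals.
\<close>

section \<open>Strictly upper triangular matrices, matrix units and the center\<close>

lemma strict_upper_mats_carrier: "A \<in> strict_upper_mats n \<Longrightarrow> A \<in> carrier_mat n n"
  by (simp add: strict_upper_mats_def)

lemma strict_upper_mats_dim:
  assumes "A \<in> strict_upper_mats n"
  shows "dim_row A = n" "dim_col A = n"
  using assms by (auto simp: strict_upper_mats_def)

lemma strict_upper_mats_lower:
  "A \<in> strict_upper_mats n \<Longrightarrow> i < n \<Longrightarrow> j \<le> i \<Longrightarrow> A $$ (i, j) = 0"
  by (simp add: strict_upper_mats_def)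

lemma strict_upper_mats_add:
  fixes A B :: "'a :: monoid_add mat"
  shows "A \<in> strict_upper_mats n \<Longrightarrow> B \<in> strict_upper_mats n \<Longrightarrow> A + B \<in> strict_upper_mats n"
  by (auto simp: strict_upper_mats_def)

lemma strict_upper_mats_smult:
  fixes A :: "'a :: mult_zero mat"
  shows "A \<in> strict_upper_mats n \<Longrightarrow> c \<cdot>\<^sub>m A \<in> strict_upper_mats n"
  by (auto simp: strict_upper_mats_def)

lemma mat_unit_in_strict_upper_mats:
  "i < j \<Longrightarrow> mat_unit n i j \<in> strict_upper_mats n"
  by (auto simp: strict_upper_mats_def mat_unit_def)

lemma index_mat_unit:
  "k < n \<Longrightarrow> l < n \<Longrightarrow> mat_unit n i j $$ (k, l) = (if k = i \<and> l = j then 1 else 0)"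
  by (simp add: mat_unit_def)

lemma index_mult_mat_sum:
  assumes "A \<in> carrier_mat n n" "B \<in> carrier_mat n n" "i < n" "j < n"
  shows "(A * B) $$ (i, j) = (\<Sum>k<n. A $$ (i, k) * B $$ (k, j))"
  using assms by (simp add: scalar_prod_def lessThan_atLeast0)

lemma index_mult_mat_unit:
  fixes A :: "'a :: semiring_1 mat"
  assumes "A \<in> carrier_mat n n" "i < n" "j < n" "k < n"
  shows "(A * mat_unit n k l) $$ (i, j) = (if j = l then A $$ (i, k) else 0)"
proof -
  have "(A * mat_unit n k l) $$ (i, j) = (\<Sum>m<n. A $$ (i, m) * mat_unit n k l $$ (m, j))"
    using assms by (intro index_mult_mat_sum) (auto simp: mat_unit_def)
  also have "\<dots> = (\<Sum>m<n. if m = k then (if j = l then A $$ (i, k) else 0) else 0)"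
    using assms by (intro sum.cong) (auto simp: index_mat_unit)
  finally show ?thesis using assms by simp
qed

lemma index_mat_unit_mult:
  fixes A :: "'a :: semiring_1 mat"
  assumes "A \<in> carrier_mat n n" "i < n" "j < n" "l < n"
  shows "(mat_unit n k l * A) $$ (i, j) = (if i = k then A $$ (l, j) else 0)"
proof -
  have "(mat_unit n k l * A) $$ (i, j) = (\<Sum>m<n. mat_unit n k l $$ (i, m) * A $$ (m, j))"
    using assms by (intro index_mult_mat_sum) (auto simp: mat_unit_def)
  also have "\<dots> = (\<Sum>m<n. if m = l then (if i = k then A $$ (l, j) else 0) else 0)"
    using assms by (intro sum.cong) (auto simp: index_mat_unit)
  finally show ?thesis using assms by simp
qed

text \<open>Commuting with \<open>mat_unit n j (n - 1)\<close> kills the entry (i, j) above the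
  diagonal when j < n - 1, and commuting with \<open>mat_unit n 0 i\<close> kills it in the last
  column when i > 0. Hence a central matrix is supported in the top right corner.\<close>

lemma center_strict_upper_mats_index:
  fixes A :: "'a :: semiring_1 mat"
  assumes A: "A \<in> center (strict_upper_mats n)"
    and ij: "i < n" "j < n" "(i, j) \<noteq> (0, n - 1)"
  shows "A $$ (i, j) = 0"
proof -
  have mem: "A \<in> strict_upper_mats n" using A by (simp add: center_def)
  note carrier = strict_upper_mats_carrier[OF mem]
  have comm: "A * mat_unit n k l = mat_unit n k l * A" if "k < l" for k l
    using A mat_unit_in_strict_upper_mats[OF that] by (auto simp: center_def)
  show ?thesis
  proof (cases "j \<le> i")
    case True
    then show ?thesis using mem ij by (simp add: strict_upper_mats_lower)
  next
    case False
    show ?thesis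
    proof (cases "j < n - 1")
      case True
      have "A $$ (i, j) = (A * mat_unit n j (n - 1)) $$ (i, n - 1)"
        using carrier ij by (simp add: index_mult_mat_unit)
      also have "\<dots> = (mat_unit n j (n - 1) * A) $$ (i, n - 1)"
        using comm[OF True] by simp
      also have "\<dots> = 0"
        using carrier ij False by (simp add: index_mat_unit_mult)
      finally show ?thesis .
    next
      case j: False
      with ij have i: "0 < i" by auto
      have "A $$ (i, j) = (mat_unit n 0 i * A) $$ (0, j)"
        using carrier ij by (simp add: index_mat_unit_mult)
      also have "\<dots> = (A * mat_unit n 0 i) $$ (0, j)"
        using comm[OF i] by simp
      also have "\<dots> = 0"
        using carrier ij False by (simp add: index_mult_mat_unit)
      finally show ?thesis .
    qed
  qed
qed

section \<open>Commutators along superdiagonals\<close>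

text \<open>\<open>A\<close> starts on superdiagonal d and \<open>B\<close> on superdiagonal 1, so
  at distance d + 1 from the diagonal each of the two products retains a single summand: k = i + d
  in \<open>A * B\<close> and k = i + 1 in \<open>B * A\<close>.\<close>

lemma commutator_superdiagonal:
  fixes A B :: "'a :: ring mat"
  assumes A: "A \<in> carrier_mat n n" and B: "B \<in> strict_upper_mats n"
    and low: "\<And>i j. i < n \<Longrightarrow> j < n \<Longrightarrow> j < i + d \<Longrightarrow> A $$ (i, j) = 0"
    and i: "i + d + 1 < n"
  shows "commutator A B $$ (i, i + d + 1) =
    A $$ (i, i + d) * B $$ (i + d, i + d + 1) - B $$ (i, i + 1) * A $$ (i + 1, i + d + 1)"
proof -
  note cB = strict_upper_mats_carrier[OF B]
  have "(A * B) $$ (i, i + d + 1) = (\<Sum>k<n. A $$ (i, k) * B $$ (k, i + d + 1))"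
    using A cB i by (intro index_mult_mat_sum) auto
  also have "\<dots> = (\<Sum>k<n. if k = i + d then A $$ (i, k) * B $$ (k, i + d + 1) else 0)"
  proof (intro sum.cong refl)
    fix k assume "k \<in> {..<n}"
    then show "A $$ (i, k) * B $$ (k, i + d + 1) =
      (if k = i + d then A $$ (i, k) * B $$ (k, i + d + 1) else 0)"
      using low[of i k] strict_upper_mats_lower[OF B, of k "i + d + 1"] i
      by (cases k "i + d" rule: linorder_cases) auto
  qed
  also have "\<dots> = A $$ (i, i + d) * B $$ (i + d, i + d + 1)" using i by simp
  finally have AB: "(A * B) $$ (i, i + d + 1) = A $$ (i, i + d) * B $$ (i + d, i + d + 1)" .
  have "(B * A) $$ (i, i + d + 1) = (\<Sum>k<n. B $$ (i, k) * A $$ (k, i + d + 1))"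
    using A cB i by (intro index_mult_mat_sum) auto
  also have "\<dots> = (\<Sum>k<n. if k = i + 1 then B $$ (i, k) * A $$ (k, i + d + 1) else 0)"
  proof (intro sum.cong refl)
    fix k assume "k \<in> {..<n}"
    then show "B $$ (i, k) * A $$ (k, i + d + 1) =
      (if k = i + 1 then B $$ (i, k) * A $$ (k, i + d + 1) else 0)"
      using low[of k "i + d + 1"] strict_upper_mats_lower[OF B, of i k] i
      by (cases k "i + 1" rule: linorder_cases) auto
  qed
  also have "\<dots> = B $$ (i, i + 1) * A $$ (i + 1, i + d + 1)" using i by simp
  finally have BA: "(B * A) $$ (i, i + d + 1) = B $$ (i, i + 1) * A $$ (i + 1, i + d + 1)" .
  show ?thesis
    using A cB i AB BA by (simp add: commutator_def)
qed

text \<open>\<open>X\<close> commutes with its own multiples. This lets the centrality hypothesis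
  survive the passage from \<open>g\<close> to \<open>g\<close> minus a scalar.\<close>

lemma commutator_add_smult_self:
  fixes A X :: "'a :: comm_ring mat"
  assumes A: "A \<in> carrier_mat n n" and X: "X \<in> carrier_mat n n"
  shows "commutator (A + c \<cdot>\<^sub>m X) X = commutator A X"
proof -
  have "(A + c \<cdot>\<^sub>m X) * X = A * X + c \<cdot>\<^sub>m (X * X)"
    using A X by (simp add: add_mult_distrib_mat[of _ n n] mult_smult_assoc_mat[of _ n n])
  moreover have "X * (A + c \<cdot>\<^sub>m X) = X * A + c \<cdot>\<^sub>m (X * X)"
    using A X by (simp add: mult_add_distrib_mat[of _ n n] mult_smult_distrib[of _ n n])
  ultimately show ?thesis
    using A X unfolding commutator_def by (intro eq_matI) auto
qed

section \<open>Linear functionals tied to coordinates\<close>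

text \<open>Scalar-valued counterpart of \<open>linear_map_on\<close>, meant for the single entries
  of \<open>g X\<close> as functions of \<open>X\<close>.\<close>

definition linear_functional_on :: "'a :: semiring_0 mat set \<Rightarrow> ('a mat \<Rightarrow> 'a) \<Rightarrow> bool" where
  "linear_functional_on V f \<longleftrightarrow>
    (\<forall>X \<in> V. \<forall>Y \<in> V. f (X + Y) = f X + f Y) \<and> (\<forall>c. \<forall>X \<in> V. f (c \<cdot>\<^sub>m X) = c * f X)"

lemma linear_functional_on_index:
  assumes lin: "linear_map_on (strict_upper_mats n) g"
    and g: "g \<in> strict_upper_mats n \<rightarrow> strict_upper_mats n"
    and ij: "i < n" "j < n"
  shows "linear_functional_on (strict_upper_mats n) (\<lambda>X. g X $$ (i, j))"
proof -
  have "dim_row (g X) = n \<and> dim_col (g X) = n" if "X \<in> strict_upper_mats n" for X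
    using strict_upper_mats_dim funcset_mem[OF g that] by blast
  then show ?thesis
    using lin ij by (auto simp: linear_functional_on_def linear_map_on_def additive_on_def)
qed

text \<open>It suffices that \<open>f\<close> vanishes on the hyperplane where the (p, q) entry is
  0. There the equation reads \<open>f X * X $$ (r, s) = 0\<close>, which settles the case of a
  nonzero (r, s) entry; the remaining case is reduced to it by a shift.\<close>

lemma linear_functional_multiple_of_index:
  fixes f h :: "'a :: field mat \<Rightarrow> 'a"
  assumes f: "linear_functional_on (strict_upper_mats n) f"
    and pq: "p < q" "q < n" and rs: "r < s" "s < n" and ne: "(p, q) \<noteq> (r, s)"
    and eq: "\<And>X. X \<in> strict_upper_mats n \<Longrightarrow> f X * X $$ (r, s) = X $$ (p, q) * h X"
    and X: "X \<in> strict_upper_mats n"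
  shows "f X = f (mat_unit n p q) * X $$ (p, q)"
proof -
  have add: "f (A + B) = f A + f B"
    if "A \<in> strict_upper_mats n" "B \<in> strict_upper_mats n" for A B
    using f that by (simp add: linear_functional_on_def)
  have smult: "f (c \<cdot>\<^sub>m A) = c * f A" if "A \<in> strict_upper_mats n" for c A
    using f that by (simp add: linear_functional_on_def)
  let ?E = "mat_unit n p q :: 'a mat" and ?E' = "mat_unit n r s :: 'a mat"
  have E: "?E \<in> strict_upper_mats n" "?E' \<in> strict_upper_mats n"
    using pq rs by (auto intro: mat_unit_in_strict_upper_mats)
  note dims = strict_upper_mats_dim[OF E(1)] strict_upper_mats_dim[OF E(2)]
  have nonzero: "f Y = 0"
    if "Y \<in> strict_upper_mats n" "Y $$ (p, q) = 0" "Y $$ (r, s) \<noteq> 0" for Y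
    using eq[OF that(1)] that(2,3) by simp
  have Ers: "f ?E' = 0"
    using nonzero[OF E(2)] pq rs ne by (auto simp: index_mat_unit)
  have kernel: "f Y = 0" if Y: "Y \<in> strict_upper_mats n" "Y $$ (p, q) = 0" for Y
  proof (cases "Y $$ (r, s) = 0")
    case True
    \<comment> \<open>The shift by \<open>?E'\<close> makes the (r, s) entry 1 and leaves the (p, q)
      entry 0.\<close>
    have "f (Y + ?E') = 0"
      using strict_upper_mats_dim[OF Y(1)] dims Y True pq rs ne
      by (intro nonzero strict_upper_mats_add E) (auto simp: index_mat_unit)
    with add[OF Y(1) E(2)] Ers show ?thesis by simp
  next
    case False
    with nonzero Y show ?thesis by simp
  qed
  \<comment> \<open>Removing the (p, q) entry of \<open>X\<close> projects it onto the
    hyperplane.\<close>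
  have "f (X + (- X $$ (p, q)) \<cdot>\<^sub>m ?E) = 0"
    using strict_upper_mats_dim[OF X] dims pq
    by (intro kernel strict_upper_mats_add strict_upper_mats_smult E X)
      (auto simp: index_mat_unit)
  then show ?thesis
    using add[OF X strict_upper_mats_smult[OF E(1)]] smult[OF E(1)] by (simp add: mult.commute)
qed

text \<open>The equation is symmetric under exchanging \<open>f\<close> with \<open>h\<close> and
  (p, q) with (r, s), so each functional is a multiple of its coordinate. It remains to identify the
  two scalars.\<close>

lemma linear_functionals_proportional:
  fixes f h :: "'a :: field mat \<Rightarrow> 'a"
  assumes f: "linear_functional_on (strict_upper_mats n) f"
    and h: "linear_functional_on (strict_upper_mats n) h"
    and pq: "p < q" "q < n" and rs: "r < s" "s < n" and ne: "(p, q) \<noteq> (r, s)"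
    and eq: "\<And>X. X \<in> strict_upper_mats n \<Longrightarrow> f X * X $$ (r, s) = X $$ (p, q) * h X"
  shows "\<exists>c. \<forall>X \<in> strict_upper_mats n. f X = c * X $$ (p, q) \<and> h X = c * X $$ (r, s)"
proof -
  let ?P = "mat_unit n p q :: 'a mat" and ?R = "mat_unit n r s :: 'a mat"
  have f': "f X = f ?P * X $$ (p, q)" if "X \<in> strict_upper_mats n" for X
    using linear_functional_multiple_of_index[OF f pq rs ne eq that] .
  have h': "h X = h ?R * X $$ (r, s)" if "X \<in> strict_upper_mats n" for X
    using ne eq that
    by (intro linear_functional_multiple_of_index[OF h rs pq, where h = f])
      (auto simp: mult.commute)
  have E: "?P \<in> strict_upper_mats n" "?R \<in> strict_upper_mats n"
    using pq rs by (auto intro: mat_unit_in_strict_upper_mats)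
  note sum = strict_upper_mats_add[OF E]
  \<comment> \<open>With both coordinates equal to 1, the equation compares the two scalars
    directly.\<close>
  have "(?P + ?R) $$ (p, q) = 1" "(?P + ?R) $$ (r, s) = 1"
    using strict_upper_mats_dim[OF E(1)] strict_upper_mats_dim[OF E(2)] pq rs ne
    by (auto simp: index_mat_unit)
  then have "f ?P = h ?R"
    using eq[OF sum] f'[OF sum] h'[OF sum] by simp
  with f' h' show ?thesis by auto
qed

section \<open>The superdiagonals of a centralizing map\<close>

text \<open>The (i, i + d + 1) entry of the commutator vanishes and gives an equation between two
  functionals. The bound 1 \<le> d makes the two coordinates of \<open>X\<close> different.\<close>

lemma superdiagonal_neighbours_proportional:
  fixes g :: "'a :: field mat \<Rightarrow> 'a mat"
  assumes g: "g \<in> strict_upper_mats n \<rightarrow> strict_upper_mats n"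
    and lin: "linear_map_on (strict_upper_mats n) g"
    and central: "\<And>X. X \<in> strict_upper_mats n \<Longrightarrow>
      commutator (g X) X \<in> center (strict_upper_mats n)"
    and low: "\<And>X i j. X \<in> strict_upper_mats n \<Longrightarrow> i < n \<Longrightarrow> j < n \<Longrightarrow> j < i + d \<Longrightarrow> g X $$ (i, j) = 0"
    and d: "1 \<le> d" "d + 2 < n" and i: "i + d + 1 < n"
  shows "\<exists>c. \<forall>X \<in> strict_upper_mats n.
    g X $$ (i, i + d) = c * X $$ (i, i + 1) \<and>
    g X $$ (i + 1, i + d + 1) = c * X $$ (i + d, i + d + 1)"
proof (rule linear_functionals_proportional)
  fix X :: "'a mat" assume X: "X \<in> strict_upper_mats n"
  have "g X \<in> carrier_mat n n"
    using g X by (auto intro: strict_upper_mats_carrier)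
  then have "commutator (g X) X $$ (i, i + d + 1) =
      g X $$ (i, i + d) * X $$ (i + d, i + d + 1) - X $$ (i, i + 1) * g X $$ (i + 1, i + d + 1)"
    using X low i by (intro commutator_superdiagonal) auto
  \<comment> \<open>Since d + 2 < n, this position is not the corner even for i = 0.\<close>
  moreover have "commutator (g X) X $$ (i, i + d + 1) = 0"
    using d i by (intro center_strict_upper_mats_index[OF central[OF X]]) auto
  ultimately show "g X $$ (i, i + d) * X $$ (i + d, i + d + 1) =
      X $$ (i, i + 1) * g X $$ (i + 1, i + d + 1)"
    by simp
qed (use d i in \<open>auto intro: linear_functional_on_index[OF lin g]\<close>)

text \<open>For d = 1 the pairs of neighbouring entries overlap, so the scalar found at (0, 1) is
  passed down the whole superdiagonal.\<close>

lemma first_superdiagonal_scalar: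
  fixes g :: "'a :: field mat \<Rightarrow> 'a mat"
  assumes n: "n \<ge> 4"
    and g: "g \<in> strict_upper_mats n \<rightarrow> strict_upper_mats n"
    and lin: "linear_map_on (strict_upper_mats n) g"
    and central: "\<And>X. X \<in> strict_upper_mats n \<Longrightarrow>
      commutator (g X) X \<in> center (strict_upper_mats n)"
  shows "\<exists>c. \<forall>i. i + 1 < n \<longrightarrow>
    (\<forall>X \<in> strict_upper_mats n. g X $$ (i, i + 1) = c * X $$ (i, i + 1))"
proof -
  have low: "g X $$ (i, j) = 0"
    if "X \<in> strict_upper_mats n" "i < n" "j < n" "j < i + 1" for X i j
    using g that by (intro strict_upper_mats_lower[of _ n]) auto
  have step: "\<exists>c. \<forall>X \<in> strict_upper_mats n.
      g X $$ (i, i + 1) = c * X $$ (i, i + 1) \<and>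
      g X $$ (i + 1, i + 2) = c * X $$ (i + 1, i + 2)" if "i + 2 < n" for i
    using superdiagonal_neighbours_proportional[OF g lin central low, of 1 i] n that
    by (simp add: numeral_2_eq_2)
  obtain c where c: "\<And>X. X \<in> strict_upper_mats n \<Longrightarrow> g X $$ (0, 1) = c * X $$ (0, 1)"
    using step[of 0] n by auto
  have "\<forall>X \<in> strict_upper_mats n. g X $$ (i, i + 1) = c * X $$ (i, i + 1)"
    if "i + 1 < n" for i
    using that
  proof (induction i)
    case 0
    then show ?case using c by simp
  next
    case (Suc i)
    obtain c' where c': "\<forall>X \<in> strict_upper_mats n.
        g X $$ (i, i + 1) = c' * X $$ (i, i + 1) \<and>
        g X $$ (i + 1, i + 2) = c' * X $$ (i + 1, i + 2)"
      using step[of i] Suc.prems by auto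
    let ?E = "mat_unit n i (i + 1) :: 'a mat"
    have E: "?E \<in> strict_upper_mats n" by (simp add: mat_unit_in_strict_upper_mats)
    have "?E $$ (i, i + 1) = 1" using Suc.prems by (simp add: index_mat_unit)
    \<comment> \<open>Both scalars describe the entry at (i, i + 1); evaluation at \<open>?E\<close>
      equates them.\<close>
    then have "c' = c" using c' Suc E by fastforce
    with c' show ?case by simp
  qed
  then show ?thesis by blast
qed

text \<open>The entry (1, d + 1) of \<open>g X\<close> occurs in the equations for i = 0 and i = 1:
  it is a multiple of the (d, d + 1) entry of \<open>X\<close> and also of its (1, 2) entry. For d
  \<ge> 2 these are independent coordinates, so the scalar is 0, and zero then spreads along the
  superdiagonal.\<close>

lemma next_superdiagonal_zero:
  fixes g :: "'a :: field mat \<Rightarrow> 'a mat"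
  assumes g: "g \<in> strict_upper_mats n \<rightarrow> strict_upper_mats n"
    and lin: "linear_map_on (strict_upper_mats n) g"
    and central: "\<And>X. X \<in> strict_upper_mats n \<Longrightarrow>
      commutator (g X) X \<in> center (strict_upper_mats n)"
    and low: "\<And>X i j. X \<in> strict_upper_mats n \<Longrightarrow> i < n \<Longrightarrow> j < n \<Longrightarrow> j < i + d \<Longrightarrow> g X $$ (i, j) = 0"
    and d: "2 \<le> d" "d + 2 < n"
    and X: "X \<in> strict_upper_mats n" and i: "i + d < n"
  shows "g X $$ (i, i + d) = 0"
proof -
  have step: "\<exists>c. \<forall>X \<in> strict_upper_mats n.
    g X $$ (i, i + d) = c * X $$ (i, i + 1) \<and>
    g X $$ (i + 1, i + d + 1) = c * X $$ (i + d, i + d + 1)" if "i + d + 1 < n" for i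
    using superdiagonal_neighbours_proportional[OF g lin central low, of d i] d that by simp
  obtain c where c: "\<forall>X \<in> strict_upper_mats n.
      g X $$ (0, d) = c * X $$ (0, 1) \<and> g X $$ (1, d + 1) = c * X $$ (d, d + 1)"
    using step[of 0] d by auto
  obtain c' where c': "\<forall>X \<in> strict_upper_mats n. g X $$ (1, d + 1) = c' * X $$ (1, 2)"
    using step[of 1] d by (auto simp: numeral_2_eq_2)
  \<comment> \<open>This unit separates the two coordinates: its (d, d + 1) entry is 1 and its (1,
    2) entry is 0.\<close>
  let ?E = "mat_unit n d (d + 1) :: 'a mat"
  have E: "?E \<in> strict_upper_mats n" by (simp add: mat_unit_in_strict_upper_mats)
  have "?E $$ (d, d + 1) = 1" "?E $$ (1, 2) = 0"
    using d by (auto simp: index_mat_unit)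
  then have "c = 0"
    using c[rule_format, OF E] c'[rule_format, OF E] by simp
  then have zero: "\<forall>X \<in> strict_upper_mats n. g X $$ (0, d) = 0"
    using c by simp
  \<comment> \<open>The claim is made for all matrices at once because the induction step evaluates
    the induction hypothesis at a matrix unit.\<close>
  have "\<forall>X \<in> strict_upper_mats n. g X $$ (i, i + d) = 0"
    using i
  proof (induction i)
    case 0
    then show ?case using zero by simp
  next
    case (Suc i)
    obtain b where b: "\<forall>X \<in> strict_upper_mats n.
        g X $$ (i, i + d) = b * X $$ (i, i + 1) \<and>
        g X $$ (i + 1, i + d + 1) = b * X $$ (i + d, i + d + 1)"
      using step[of i] Suc.prems by auto
    let ?E = "mat_unit n i (i + 1) :: 'a mat"
    have E: "?E \<in> strict_upper_mats n" by (simp add: mat_unit_in_strict_upper_mats)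
    have "?E $$ (i, i + 1) = 1" using Suc.prems by (simp add: index_mat_unit)
    then have "b = 0"
      using b[rule_format, OF E] Suc E by simp
    with b show ?case by simp
  qed
  with X show ?thesis by blast
qed

text \<open>The superdiagonals n - 2 and n - 1 contain just three positions, those of the matrix
  units spanning \<open>Omega n\<close>.\<close>

lemma Omega_superdiagonals:
  fixes A :: "'a :: field mat"
  assumes A: "A \<in> carrier_mat n n" and n: "n \<ge> 3"
    and low: "\<And>i j. i < n \<Longrightarrow> j < n \<Longrightarrow> j < i + (n - 2) \<Longrightarrow> A $$ (i, j) = 0"
  shows "A \<in> Omega n"
proof -
  have "A = A $$ (0, n - 2) \<cdot>\<^sub>m mat_unit n 0 (n - 2)
      + A $$ (0, n - 1) \<cdot>\<^sub>m mat_unit n 0 (n - 1) + A $$ (1, n - 1) \<cdot>\<^sub>m mat_unit n 1 (n - 1)"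
    (is "A = ?B")
  proof (rule eq_matI)
    fix i j assume "i < dim_row ?B" "j < dim_col ?B"
    then have ij: "i < n" "j < n" by (auto simp: mat_unit_def)
    consider "j < i + (n - 2)" | "(i, j) = (0, n - 2)" | "(i, j) = (0, n - 1)" | "(i, j) = (1, n - 1)"
      using ij n by force
    then show "A $$ (i, j) = ?B $$ (i, j)"
      by cases (use ij n low[of i j] in \<open>auto simp: mat_unit_def\<close>)
  qed (use A in \<open>auto simp: mat_unit_def\<close>)
  then show ?thesis unfolding Omega_def by blast
qed

section \<open>Splitting off the scalar part\<close>

theorem corollary1p3:
  fixes n :: nat
    and g :: "'a :: field_char_0 mat \<Rightarrow> 'a mat"
  assumes "n \<ge> 4"
    and "g \<in> strict_upper_mats n \<rightarrow> strict_upper_mats n"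
    and "linear_map_on (strict_upper_mats n) g"
    and "\<forall>X \<in> strict_upper_mats n. commutator (g X) X \<in> center (strict_upper_mats n)"
  shows "\<exists>(lam :: 'a) \<mu>. \<mu> \<in> strict_upper_mats n \<rightarrow> Omega n
    \<and> additive_on (strict_upper_mats n) \<mu>
    \<and> (\<forall>X \<in> strict_upper_mats n. g X = lam \<cdot>\<^sub>m X + \<mu> X)"
proof -
  let ?V = "strict_upper_mats n :: 'a mat set"
  have gV: "g X \<in> ?V" if "X \<in> ?V" for X using assms(2) that by auto
  have dims: "X \<in> carrier_mat n n" "g X \<in> carrier_mat n n" if "X \<in> ?V" for X
    using that gV[OF that] by (auto intro: strict_upper_mats_carrier)
  obtain lam where lam: "\<And>i X. i + 1 < n \<Longrightarrow> X \<in> ?V \<Longrightarrow> g X $$ (i, i + 1) = lam * X $$ (i, i + 1)"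
    using first_superdiagonal_scalar[OF assms(1-3)] assms(4) by blast
  \<comment> \<open>Subtraction is written as adding a multiple of \<open>X\<close>, the form in
    which \<open>commutator_add_smult_self\<close> applies.\<close>
  define \<mu> where "\<mu> X = g X + (- lam) \<cdot>\<^sub>m X" for X
  have \<mu>V: "\<mu> \<in> ?V \<rightarrow> ?V"
    unfolding \<mu>_def by (auto intro: strict_upper_mats_add strict_upper_mats_smult gV)
  have \<mu>add: "\<mu> (X + Y) = \<mu> X + \<mu> Y" if "X \<in> ?V" "Y \<in> ?V" for X Y
  proof -
    have "g (X + Y) = g X + g Y"
      using assms(3) that by (simp add: linear_map_on_def additive_on_def)
    then show ?thesis
      unfolding \<mu>_def using dims[OF that(1)] dims[OF that(2)]
      by (intro eq_matI) (auto simp: algebra_simps)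
  qed
  have \<mu>smult: "\<mu> (c \<cdot>\<^sub>m X) = c \<cdot>\<^sub>m \<mu> X" if "X \<in> ?V" for c X
  proof -
    have "g (c \<cdot>\<^sub>m X) = c \<cdot>\<^sub>m g X"
      using assms(3) that by (simp add: linear_map_on_def)
    then show ?thesis
      unfolding \<mu>_def using dims[OF that]
      by (intro eq_matI) (auto simp: algebra_simps)
  qed
  have \<mu>lin: "linear_map_on ?V \<mu>"
    using \<mu>add \<mu>smult by (simp add: linear_map_on_def additive_on_def)
  have \<mu>central: "commutator (\<mu> X) X \<in> center ?V" if "X \<in> ?V" for X
    using assms(4) that commutator_add_smult_self[OF dims(2,1)[OF that]]
    by (simp add: \<mu>_def)
  \<comment> \<open>Induction clears one superdiagonal at a time. The choice of \<open>lam\<close>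
    clears the first one, giving d = 2; a step from d to d + 1 has d + 2 < n, as
    \<open>next_superdiagonal_zero\<close> demands.\<close>
  have low: "\<mu> X $$ (i, j) = 0"
    if "2 \<le> d" "d + 2 \<le> n" "X \<in> ?V" "i < n" "j < n" "j < i + d" for d X i j
    using that
  proof (induction d arbitrary: X i j rule: dec_induct)
    case base
    show ?case
    proof (cases "j \<le> i")
      case True
      with base \<mu>V show ?thesis by (intro strict_upper_mats_lower[of _ n]) auto
    next
      case False
      with base have "j = i + 1" by simp
      with base lam[of i X] dims[of X] show ?thesis by (simp add: \<mu>_def)
    qed
  next
    case (step d)
    show ?case
    proof (cases "j = i + d")
      case True
      with step show ?thesis
        using next_superdiagonal_zero[OF \<mu>V \<mu>lin \<mu>central, of d X i] by simp
    next
      case False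
      with step show ?thesis by simp
    qed
  qed
  have "\<mu> \<in> ?V \<rightarrow> Omega n"
  proof
    fix X assume X: "X \<in> ?V"
    then have "\<mu> X \<in> carrier_mat n n"
      using \<mu>V by (auto intro: strict_upper_mats_carrier)
    \<comment> \<open>The induction ends at d = n - 2: the next equation would sit in the corner,
      where a central matrix may be nonzero.\<close>
    then show "\<mu> X \<in> Omega n"
      using assms(1) low[of "n - 2", OF _ _ X] by (intro Omega_superdiagonals) auto
  qed
  moreover have "additive_on ?V \<mu>" using \<mu>lin by (simp add: linear_map_on_def)
  moreover have "g X = lam \<cdot>\<^sub>m X + \<mu> X" if "X \<in> ?V" for X
    unfolding \<mu>_def using dims[OF that] by (intro eq_matI) auto
  ultimately show ?thesis by blast
qed

end
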